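(* Let $p_{2n}(x)=P_{n,n}(x)$ and $p_{2n+1}(x)=P_{n+1,n}(x)$, where $P_{n,m}$ are the multiple orthogonal polynomials associated with the modified Bessel functions $K_\nu$ and $K_{\nu+1}$ (with parameters $\alpha$ and $\nu$). Then \[ \lim_{n\to\infty}(-1)^n\frac{p_n(z/n)}{(\alpha+1)_n(\alpha+\nu+1)_n}={}_0F_2(-;\alpha+1,\alpha+\nu+1;-z), \] uniformly on compact subsets of $\mathbb{C}$.
   Context: Notation: $(a)_k=a(a+1)\cdots(a+k-1)$, $(a)_0=1$, is the Pochhammer symbol; ${}_0F_2(-;b_1,b_2;x)=\sum_{k=0}^\infty\frac{x^k}{(b_1)_k(b_2)_k\,k!}$ and ${}_1F_2(a;b_1,b_2;x)=\sum_{k=0}^\infty\frac{(a)_k\,x^k}{(b_1)_k(b_2)_k\,k!}$ are hypergeometric functions; $K_\nu$ is the modified Bessel function of the second kind. The multiple orthogonal polynomial $P_{n,m}$ has degree $n+m$ and satisfies the orthogonality relations \[ \int_0^\infty x^kP_{n,m}(x)\,x^{\alpha+\nu/2}K_\nu(2\sqrt{x})\,dx=0,\qquad 0\le k\le n-1, \] \[ \int_0^\infty x^kP_{n,m}(x)\,x^{\alpha+(\nu+1)/2}K_{\nu+1}(2\sqrt{x})\,dx=0,\qquad 0\le k\le m-1. \] An explicit expression for the polynomials $p_n$, in the normalization used, is \[ p_n(x)=(-1)^n(\alpha+1)_n(\alpha+\nu+1)_n\;{}_1F_2(-n;\alpha+1,\alpha+\nu+1;x). \] *)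

theory Defs
  imports "HOL-Analysis.Analysis"
begin

text \<open>The modified Bessel function of the second kind (Macdonald function) of real order, for
  positive argument, given by its classical integral representation (DLMF 10.32.9). The integral
  converges for every real order and every positive argument.\<close>

definition bessel_K :: "real \<Rightarrow> real \<Rightarrow> real" where
  "bessel_K \<nu> x = integral {0..} (\<lambda>t. exp (- x * cosh t) * cosh (\<nu> * t))"

definition bessel_K_weight :: "real \<Rightarrow> real \<Rightarrow> real \<Rightarrow> real" where
  "bessel_K_weight \<alpha> \<nu> x = x powr (\<alpha> + \<nu> / 2) * bessel_K \<nu> (2 * sqrt x)"

text \<open>Type II multiple orthogonal polynomial of multi-index \<open>(n, m)\<close>, in the monic
  normalization. The first weight has parameters \<open>(\<alpha>, \<nu>)\<close>, the second \<open>(\<alpha>, \<nu> + 1)\<close>. The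
  integrals over the half-line are required to exist and to vanish.\<close>

definition is_bessel_K_mop :: "real \<Rightarrow> real \<Rightarrow> nat \<Rightarrow> nat \<Rightarrow> real poly \<Rightarrow> bool" where
  "is_bessel_K_mop \<alpha> \<nu> n m P \<longleftrightarrow>
     degree P = n + m \<and> lead_coeff P = 1 \<and>
     (\<forall>k<n. ((\<lambda>x. x ^ k * poly P x * bessel_K_weight \<alpha> \<nu> x) has_integral 0) {0<..}) \<and>
     (\<forall>k<m. ((\<lambda>x. x ^ k * poly P x * bessel_K_weight \<alpha> (\<nu> + 1) x) has_integral 0) {0<..})"

definition bessel_K_mop :: "real \<Rightarrow> real \<Rightarrow> nat \<Rightarrow> nat \<Rightarrow> real poly" where
  "bessel_K_mop \<alpha> \<nu> n m = (THE P. is_bessel_K_mop \<alpha> \<nu> n m P)"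

definition bessel_K_step :: "real \<Rightarrow> real \<Rightarrow> nat \<Rightarrow> real poly" where
  "bessel_K_step \<alpha> \<nu> n =
     (if even n then bessel_K_mop \<alpha> \<nu> (n div 2) (n div 2)
      else bessel_K_mop \<alpha> \<nu> (n div 2 + 1) (n div 2))"

definition hypergeo_0F2 :: "complex \<Rightarrow> complex \<Rightarrow> complex \<Rightarrow> complex" where
  "hypergeo_0F2 b1 b2 x = (\<Sum>k. x ^ k / (pochhammer b1 k * pochhammer b2 k * fact k))"

end

theory Submission
  imports Defs
begin

text \<open>
  Substituting \<open>u = sqrt x * exp (\<plusminus> t)\<close> and applying Tonelli, the moments of the weights are
  products of two Gamma values. With \<open>a = \<alpha> + 1\<close> and \<open>b = \<alpha> + \<nu> + 1\<close>, the two families of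
  orthogonality conditions for \<open>P = (\<Sum>j. c j * x ^ j)\<close> say that
  \<open>(\<Sum>j. c j * Gamma (a + j) * Gamma (b + j) * q j) = 0\<close> for
  \<open>q x = pochhammer (a + x) k * pochhammer (b + x) k\<close> and
  \<open>q x = pochhammer (a + x) k * pochhammer (b + x) (k + 1)\<close>. On the step line these \<open>q\<close> have
  exactly one representative of every degree below \<open>n\<close>, so the conditions hold for all polynomials
  \<open>q\<close> of degree below \<open>n\<close>. Lagrange interpolation then gives uniqueness of the monic solution,
  and the vanishing of \<open>n\<close>-th differences identifies it explicitly. The limit is Tannery's
  theorem applied with a majorant that is uniform on the compact set.
\<close>

section \<open>Moments of the Bessel weights\<close>

lemma Gamma_integral_real_open:
  assumes "a > (0 :: real)"
  shows "((\<lambda>t. t powr (a - 1) / exp t) has_integral Gamma a) {0<..}"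
proof -
  have "{t \<in> {0..} - {0<..}. t powr (a - 1) / exp t \<noteq> 0} = {}"
    "{t \<in> {0<..} - {0..}. t powr (a - 1) / exp t \<noteq> 0} = {}"
    by auto
  then show ?thesis
    using Gamma_integral_real[OF assms]
    by (subst has_integral_spike_set_eq[where T = "{0..}"]) (simp_all only: negligible_empty)
qed

text \<open>Decay at infinity comes from \<open>exp (- u)\<close>. Near 0 a single term of the
  exponential series gives exp(-x/u) \<le> m! (u/x)^m, which trades the possibly singular power of u
  for an integrable one.\<close>

lemma kernel_absolutely_integrable:
  fixes x \<nu> :: real
  assumes "x > 0"
  shows "(\<lambda>u. u powr (\<nu> - 1) * exp (- u - x / u)) absolutely_integrable_on {0<..}"
proof -
  \<comment> \<open>This choice makes \<open>\<nu> + m\<close> positive, so that the majorant is a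
    multiple of the Gamma integrand for \<open>\<nu> + m\<close>.\<close>
  obtain m :: nat where m: "real m > - \<nu>"
    using reals_Archimedean2 by blast
  have *: "(\<lambda>u. u powr (\<nu> + m - 1) / exp u) integrable_on {0<..}"
    using Gamma_integral_real_open[of "\<nu> + m"] m by (auto simp: integrable_on_def)
  have int: "(\<lambda>u. (fact m / x ^ m) * (u powr (\<nu> + m - 1) / exp u)) integrable_on {0<..}"
    using integrable_on_cmult_left[OF *, of "fact m / x ^ m"] by simp
  have bound: "norm (u powr (\<nu> - 1) * exp (- u - x / u))
      \<le> (fact m / x ^ m) * (u powr (\<nu> + m - 1) / exp u)" if "u > 0" for u
  proof -
    have "(x / u) ^ m / fact m \<le> exp (x / u)"
      using that assms sum_le_suminf[OF summable_exp_generic[of "x / u"], of "{m}"]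
      by (simp add: exp_def field_simps)
    then have "exp (- (x / u)) \<le> fact m * u ^ m / x ^ m"
      using that assms by (simp add: exp_minus field_simps)
    then have "u powr (\<nu> - 1) * exp (- u) * exp (- (x / u))
       \<le> u powr (\<nu> - 1) * exp (- u) * (fact m * u ^ m / x ^ m)"
      by (intro mult_left_mono) auto
    also have "\<dots> = (fact m / x ^ m) * (u powr (\<nu> + m - 1) / exp u)"
      using that by (simp add: exp_minus powr_add powr_diff powr_realpow field_simps)
    finally show ?thesis
      by (simp add: exp_diff exp_minus field_simps)
  qed
  show ?thesis
    by (rule measurable_bounded_by_integrable_imp_absolutely_integrable[OF _ _ int])
       (use bound in \<open>auto intro!: continuous_imp_measurable_on_sets_lebesgue continuous_intros\<close>)
qed

text \<open>The half-line is cut at u = sqrt x, where u and x/u balance. With u = sqrt x * exp(t)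
  above and u = sqrt x * exp(-t) below, the exponent is -2 sqrt x cosh t on both pieces, and the
  factors exp(\<nu> t) and exp(-\<nu> t) add up to 2 cosh(\<nu> t).\<close>

lemma kernel_has_integral_bessel_K:
  fixes x \<nu> :: real
  assumes x: "x > 0"
  shows "((\<lambda>u. u powr (\<nu> - 1) * exp (- u - x / u)) has_integral
           2 * x powr (\<nu> / 2) * bessel_K \<nu> (2 * sqrt x)) {0<..}"
proof -
  define s where "s = sqrt x"
  define f where "f = (\<lambda>u. u powr (\<nu> - 1) * exp (- u - x / u))"
  have s: "s > 0" "s * s = x" using x by (auto simp: s_def)
  have f: "f absolutely_integrable_on {0<..}"
    unfolding f_def using x by (rule kernel_absolutely_integrable)
  \<comment> \<open>Up to the constant \<open>s powr \<nu>\<close>, this is the pullback of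
    \<open>f\<close>, Jacobian included, under u = s * exp(c * t); c = 1 and c = -1 select the upper
    and the lower piece.\<close>
  define G where "G c t = exp (- (2 * s) * cosh t) * exp (c * \<nu> * t)" for c t :: real
  have im1: "(\<lambda>t. s * exp (1 * t)) ` {0..} = {s..}"
  proof (intro equalityI subsetI)
    fix y assume "y \<in> {s..}"
    then have "y = s * exp (1 * ln (y / s))" "ln (y / s) \<in> {0..}"
      using s by auto
    then show "y \<in> (\<lambda>t. s * exp (1 * t)) ` {0..}" by blast
  qed (use s in auto)
  have im2: "(\<lambda>t. s * exp ((-1) * t)) ` {0..} = {0<..s}"
  proof (intro equalityI subsetI)
    fix y assume "y \<in> {0<..s}"
    then have "y = s * exp ((-1) * ln (s / y))" "ln (s / y) \<in> {0..}"
      using s by (auto simp: exp_minus)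
    then show "y \<in> (\<lambda>t. s * exp ((-1) * t)) ` {0..}" by blast
  qed (use s in auto)
  have half: "G c absolutely_integrable_on {0..} \<and>
     (f has_integral s powr \<nu> * integral {0..} (G c)) ((\<lambda>t. s * exp (c * t)) ` {0..})"
    if c: "c = 1 \<or> c = -1" for c
  proof -
    let ?g = "\<lambda>t. s * exp (c * t)"
    have eq: "\<bar>s * c * exp (c * t)\<bar> * f (?g t) = s powr \<nu> * G c t" for t
    proof -
      have "\<bar>s * c * exp (c * t)\<bar> = ?g t"
        using s c by (auto simp: abs_mult)
      moreover have "?g t * ?g t powr (\<nu> - 1) = ?g t powr \<nu>"
        using s by (simp add: powr_diff)
      moreover have "?g t powr \<nu> = s powr \<nu> * exp (c * \<nu> * t)"
        using s by (simp add: powr_def ln_mult exp_add[symmetric] algebra_simps)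
      moreover have "- ?g t - x / ?g t = - (2 * s) * cosh t"
        using s c unfolding s(2)[symmetric]
        by (auto simp: cosh_def exp_minus field_simps)
      ultimately show ?thesis
        unfolding f_def G_def by (simp add: mult_ac)
    qed
    have inj: "inj_on ?g {0..}"
      using s c by (auto simp: inj_on_def)
    have fS: "f absolutely_integrable_on ?g ` {0..}"
    proof (rule set_integrable_subset[OF f])
      show "?g ` {0..} \<in> sets lebesgue"
        using c im1 im2 by auto
    qed (use s in auto)
    have "(\<lambda>t. \<bar>s * c * exp (c * t)\<bar> * f (?g t)) absolutely_integrable_on {0..} \<and>
       integral {0..} (\<lambda>t. \<bar>s * c * exp (c * t)\<bar> * f (?g t)) = integral (?g ` {0..}) f"
      by (subst has_absolute_integral_change_of_variables_1')
         (use inj fS in \<open>auto intro!: derivative_eq_intros\<close>)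
    then have A: "(\<lambda>t. s powr \<nu> * G c t) absolutely_integrable_on {0..}"
      and B: "integral {0..} (\<lambda>t. s powr \<nu> * G c t) = integral (?g ` {0..}) f"
      by (simp_all only: eq)
    have "G c absolutely_integrable_on {0..}"
      using A s by simp
    moreover have "(f has_integral s powr \<nu> * integral {0..} (G c)) (?g ` {0..})"
      using fS B by (auto simp: has_integral_iff set_lebesgue_integral_eq_integral(1))
    ultimately show ?thesis by blast
  qed
  \<comment> \<open>The two pieces share only the point \<open>s\<close>, a null set.\<close>
  have "(f has_integral s powr \<nu> * integral {0..} (G (-1)) + s powr \<nu> * integral {0..} (G 1))
      ({0<..s} \<union> {s..})"
    using half[of 1] half[of "-1"] unfolding im1 im2
    by (intro has_integral_Un) (auto intro!: negligible_subset[OF negligible_sing[of s]])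
  moreover have "{0<..s} \<union> {s..} = {0<..}" using s by auto
  moreover have "integral {0..} (G (-1)) + integral {0..} (G 1) = 2 * bessel_K \<nu> (2 * s)"
  proof -
    have "integral {0..} (G (-1)) + integral {0..} (G 1) = integral {0..} (\<lambda>t. G (-1) t + G 1 t)"
      using half[of 1] half[of "-1"]
      by (intro integral_add[symmetric]) (auto simp: set_lebesgue_integral_eq_integral(1))
    also have "(\<lambda>t. G (-1) t + G 1 t) = (\<lambda>t. 2 * (exp (- (2 * s) * cosh t) * cosh (\<nu> * t)))"
      by (auto simp: G_def cosh_def field_simps)
    also have "integral {0..} \<dots> = 2 * bessel_K \<nu> (2 * s)"
      by (simp add: bessel_K_def)
    finally show ?thesis .
  qed
  moreover have "s powr \<nu> = x powr (\<nu> / 2)"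
    using x by (simp add: s_def powr_half_sqrt[symmetric] powr_powr)
  ultimately show ?thesis
    by (simp add: f_def s_def mult_ac flip: distrib_left)
qed

text \<open>The Gamma integral rescaled by x = c * t, as a nonnegative integral so that it can serve
  as an inner integral in Tonelli's theorem.\<close>

lemma nn_integral_powr_exp:
  fixes a c :: real
  assumes "a > 0" "c > 0"
  shows "(\<integral>\<^sup>+x. ennreal (indicator {0<..} x * (x powr (a - 1) * exp (- x / c))) \<partial>lborel)
           = ennreal (c powr a * Gamma a)"
proof -
  have *: "(\<integral>\<^sup>+t. ennreal (indicator {0<..} t * (t powr (a - 1) / exp t)) \<partial>lborel) = Gamma a"
    by (intro nn_integral_has_integral_lebesgue Gamma_integral_real_open assms) auto
  have "(\<integral>\<^sup>+x. ennreal (indicator {0<..} x * (x powr (a - 1) * exp (- x / c))) \<partial>lborel)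
     = ennreal c * (\<integral>\<^sup>+t. ennreal (indicator {0<..} (c * t) * ((c * t) powr (a - 1) * exp (- (c * t) / c))) \<partial>lborel)"
    using assms by (subst nn_integral_real_affine[where c = c and t = 0]) auto
  also have "(\<lambda>t. ennreal (indicator {0<..} (c * t) * ((c * t) powr (a - 1) * exp (- (c * t) / c))))
     = (\<lambda>t. ennreal (c powr (a - 1)) * ennreal (indicator {0<..} t * (t powr (a - 1) / exp t)))"
    using assms by (auto simp: fun_eq_iff indicator_def powr_mult exp_minus zero_less_mult_iff 
        field_simps simp flip: ennreal_mult'')
  also have "(\<integral>\<^sup>+t. ennreal (c powr (a - 1)) * ennreal (indicator {0<..} t * (t powr (a - 1) / exp t)) \<partial>lborel)
      = ennreal (c powr (a - 1)) * ennreal (Gamma a)"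
    using * by (simp add: nn_integral_cmult)
  finally show ?thesis
    using assms by (simp add: powr_diff flip: ennreal_mult'' mult.assoc)
qed

text \<open>The double integral of x^(s-1) u^(\<nu>-1) exp(-u - x/u) is computed in both orders.
  Integrating over u first produces twice the Bessel integrand; integrating over x first produces
  Gamma(s) u^(s+\<nu>-1) exp(-u), hence a product of two Gamma values.\<close>

lemma bessel_K_moment:
  fixes s \<nu> :: real
  assumes s: "s > 0" "s + \<nu> > 0"
  shows "((\<lambda>x. x powr (s - 1 + \<nu> / 2) * bessel_K \<nu> (2 * sqrt x)) has_integral
           Gamma s * Gamma (s + \<nu>) / 2) {0<..}"
proof -
  define h where "h x = indicator {0<..} x * (x powr (s - 1 + \<nu> / 2) * bessel_K \<nu> (2 * sqrt x))" for x
  define k where "k x u = indicator {0<..} x * (indicator {0<..} u *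
     (x powr (s - 1) * (u powr (\<nu> - 1) * exp (- u - x / u))))" for x u :: real
  have [measurable]: "case_prod k \<in> borel_measurable (borel \<Otimes>\<^sub>M borel)"
    unfolding k_def by measurable
  have inner_u: "(\<integral>\<^sup>+u. ennreal (k x u) \<partial>lborel) = ennreal (2 * h x) \<and> h x \<ge> 0" for x
  proof (cases "x > 0")
    case True
    have "((\<lambda>u. x powr (s - 1) * (u powr (\<nu> - 1) * exp (- u - x / u))) has_integral
        x powr (s - 1) * (2 * x powr (\<nu> / 2) * bessel_K \<nu> (2 * sqrt x))) {0<..}"
      by (intro has_integral_mult_right kernel_has_integral_bessel_K True)
    moreover have "x powr (s - 1) * (2 * x powr (\<nu> / 2) * bessel_K \<nu> (2 * sqrt x)) = 2 * h x"
      using True by (simp add: h_def powr_add)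
    ultimately have I: "((\<lambda>u. x powr (s - 1) * (u powr (\<nu> - 1) * exp (- u - x / u))) has_integral 2 * h x) {0<..}"
      by simp
    from nn_integral_has_integral_lebesgue[OF _ I] have "(\<integral>\<^sup>+u. ennreal (k x u) \<partial>lborel) = ennreal (2 * h x)"
      using True by (simp add: k_def)
    moreover have "2 * h x \<ge> 0"
      by (rule has_integral_nonneg[OF I]) auto
    ultimately show ?thesis by simp
  qed (simp add: h_def k_def)
  have inner_x: "(\<integral>\<^sup>+x. ennreal (k x u) \<partial>lborel) =
      ennreal (Gamma s) * ennreal (indicator {0<..} u * (u powr (s + \<nu> - 1) * exp (- u / 1)))" for u
  proof (cases "u > 0")
    case True
    have "exp (- u - x / u) = exp (- u) * exp (- x / u)" for x
      by (simp flip: exp_add)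
    then have "(\<lambda>x. ennreal (k x u)) = (\<lambda>x. ennreal (u powr (\<nu> - 1) * exp (- u)) *
        ennreal (indicator {0<..} x * (x powr (s - 1) * exp (- x / u))))"
      using True by (auto simp: k_def fun_eq_iff indicator_def mult_ac simp flip: ennreal_mult'')
    then have "(\<integral>\<^sup>+x. ennreal (k x u) \<partial>lborel) =
        ennreal (u powr (\<nu> - 1) * exp (- u)) * ennreal (u powr s * Gamma s)"
      using True s nn_integral_powr_exp[of s u] by (simp add: nn_integral_cmult)
    also have "\<dots> = ennreal (Gamma s * (u powr (s + \<nu> - 1) * exp (- u)))"
      using True s by (simp add: powr_add powr_diff field_simps flip: ennreal_mult'')
    finally show ?thesis
      using True s by (simp add: ennreal_mult' less_imp_le Gamma_real_pos)
  qed (simp add: k_def)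
  \<comment> \<open>Measurability of \<open>h\<close> is read off from its representation as a
    parametrized integral of the jointly measurable \<open>k\<close>.\<close>
  have "(\<lambda>x. enn2real (\<integral>\<^sup>+u. ennreal (k x u) \<partial>lborel) / 2) \<in> borel_measurable borel"
    by measurable
  then have meas: "h \<in> borel_measurable borel"
    using inner_u by simp
  have "(\<integral>\<^sup>+x. ennreal (2 * h x) \<partial>lborel) = (\<integral>\<^sup>+x. \<integral>\<^sup>+u. ennreal (k x u) \<partial>lborel \<partial>lborel)"
    using inner_u by simp
  also have "\<dots> = (\<integral>\<^sup>+u. \<integral>\<^sup>+x. ennreal (k x u) \<partial>lborel \<partial>lborel)"
    by (rule lborel_pair.Fubini') simp
  also have "\<dots> = ennreal (Gamma s) * ennreal (Gamma (s + \<nu>))"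
    unfolding inner_x using s nn_integral_powr_exp[of "s + \<nu>" 1]
    by (subst nn_integral_cmult) auto
  also have "\<dots> = ennreal (Gamma s * Gamma (s + \<nu>))"
    using s by (simp add: ennreal_mult' less_imp_le Gamma_real_pos)
  finally have "((\<lambda>x. 2 * h x) has_integral Gamma s * Gamma (s + \<nu>)) UNIV"
    using s inner_u meas
    by (intro nn_integral_has_integral) (auto simp: less_imp_le Gamma_real_pos)
  from has_integral_divide[OF this, of 2]
  have "(h has_integral Gamma s * Gamma (s + \<nu>) / 2) UNIV" by simp
  moreover have "h = (\<lambda>x. if x \<in> {0<..} then x powr (s - 1 + \<nu> / 2) * bessel_K \<nu> (2 * sqrt x) else 0)"
    by (auto simp: h_def)
  ultimately show ?thesis
    by (simp only: has_integral_restrict_UNIV)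
qed

section \<open>Finite differences and weighted sums of polynomial values\<close>

text \<open>Up to sign the sum is the n-th forward difference of p at 0. Pascal's rule turns the sum
  of order n + 1 for p(x) into the sum of order n for p(x) - p(x + 1), whose degree is smaller
  because the leading terms cancel.\<close>

lemma alternating_binomial_sum_poly:
  fixes p :: "'a::{idom,ring_char_0} poly"
  assumes "degree p < n"
  shows "(\<Sum>j\<le>n. (- 1) ^ j * of_nat (n choose j) * poly p (of_nat j)) = 0"
  using assms
proof (induction n arbitrary: p)
  case (Suc n)
  let ?q = "p - pcompose p [:1, 1:]"
  have q0: "(\<Sum>j\<le>n. (- 1) ^ j * of_nat (n choose j) * poly ?q (of_nat j)) = 0"
  proof (cases "degree p = 0")
    \<comment> \<open>A constant has difference 0; its degree cannot drop further, so the induction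
      hypothesis is not called on.\<close>
    case True
    then show ?thesis by (auto elim!: degree_eq_zeroE simp: pcompose_pCons)
  next
    case False
    have "degree ?q < degree p"
    proof (rule degree_lessI)
      show "?q \<noteq> 0 \<or> 0 < degree p" using False by auto
      show "\<forall>k\<ge>degree p. coeff ?q k = 0"
      proof (intro allI impI)
        fix k assume "k \<ge> degree p"
        then consider "k = degree p" | "k > degree p" by linarith
        then show "coeff ?q k = 0"
        proof cases
          case 1
          have "lead_coeff (pcompose p [:1, 1:]) = lead_coeff p"
            by (subst lead_coeff_comp) auto
          then show ?thesis using 1 by (simp add: degree_pcompose)
        qed (simp add: coeff_eq_0 degree_pcompose)
      qed
    qed
    then show ?thesis using Suc.prems by (intro Suc.IH) linarith
  qed
  have "(\<Sum>j\<le>Suc n. (- 1) ^ j * of_nat (Suc n choose j) * poly p (of_nat j)) =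
      (\<Sum>j\<le>n. (- 1) ^ j * of_nat (n choose j) * poly p (of_nat j)) +
      (\<Sum>j\<le>n. (- 1) ^ Suc j * of_nat (n choose j) * poly p (of_nat (Suc j)))"
  proof -
    have "(\<Sum>j\<le>Suc n. (- 1) ^ j * of_nat (Suc n choose j) * poly p (of_nat j)) = poly p 0 +
       (\<Sum>j\<le>n. (- 1) ^ Suc j * of_nat ((n choose j) + (n choose Suc j)) * poly p (of_nat (Suc j)))"
      by (subst sum.atMost_Suc_shift) simp
    also have "\<dots> = (poly p 0 + (\<Sum>j\<le>n. (- 1) ^ Suc j * of_nat (n choose Suc j) * poly p (of_nat (Suc j))))
         + (\<Sum>j\<le>n. (- 1) ^ Suc j * of_nat (n choose j) * poly p (of_nat (Suc j)))"
      by (simp add: sum.distrib algebra_simps del: of_nat_Suc power_Suc)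
    also have "poly p 0 + (\<Sum>j\<le>n. (- 1) ^ Suc j * of_nat (n choose Suc j) * poly p (of_nat (Suc j)))
         = (\<Sum>j\<le>Suc n. (- 1) ^ j * of_nat (n choose j) * poly p (of_nat j))"
      by (subst sum.atMost_Suc_shift) simp
    finally show ?thesis by simp
  qed
  also have "\<dots> = (\<Sum>j\<le>n. (- 1) ^ j * of_nat (n choose j) * poly ?q (of_nat j))"
    by (simp add: poly_pcompose algebra_simps sum.distrib sum_subtractf sum_negf)
  finally show ?case using q0 by simp
qed simp

text \<open>The sum is linear in the test polynomial, and polynomials with one representative of
  each degree below N span everything of degree below N: subtract the multiple of \<open>R i\<close>
  that cancels the leading term, and recurse.\<close>

lemma sum_poly_eq_0_from_basis:
  fixes c :: "nat \<Rightarrow> 'a::field" and R :: "nat \<Rightarrow> 'a poly"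
  assumes "\<And>i. i < N \<Longrightarrow> degree (R i) = i \<and> R i \<noteq> 0 \<and> (\<Sum>j\<in>A. c j * poly (R i) (of_nat j)) = 0"
    and "degree q < N"
  shows "(\<Sum>j\<in>A. c j * poly q (of_nat j)) = 0"
  using assms(2)
proof (induction "degree q" arbitrary: q rule: less_induct)
  case less
  define i where "i = degree q"
  define r where "r = lead_coeff q / lead_coeff (R i)"
  define q' where "q' = q - smult r (R i)"
  have R: "degree (R i) = i" "R i \<noteq> 0" "(\<Sum>j\<in>A. c j * poly (R i) (of_nat j)) = 0"
    using assms(1) less.prems by (auto simp: i_def)
  have top: "coeff q' i = 0"
    using R by (simp add: q'_def r_def flip: i_def) (metis i_def leading_coeff_0_iff)
  have le: "degree q' \<le> i"
    unfolding q'_def using R by (intro degree_diff_le) (auto simp: i_def intro: order.trans[OF degree_smult_le])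
  have "(\<Sum>j\<in>A. c j * poly q' (of_nat j)) = 0"
  \<comment> \<open>The zero polynomial has degree 0, so for i = 0 the degree does not strictly
    decrease and this case is treated apart.\<close>
  proof (cases "q' = 0")
    case False
    with top le have "degree q' < i"
      by (metis leading_coeff_0_iff order_le_less)
    then show ?thesis using less by (simp add: i_def)
  qed simp
  moreover have "q = q' + smult r (R i)" by (simp add: q'_def)
  ultimately have "(\<Sum>j\<in>A. c j * poly q (of_nat j)) = r * (\<Sum>j\<in>A. c j * poly (R i) (of_nat j))"
    by (simp add: algebra_simps sum.distrib sum_distrib_left)
  with R show ?case by simp
qed

text \<open>Testing with the unnormalized Lagrange polynomial, which vanishes at every node except
  i, isolates the single weight \<open>c i\<close>.\<close>

lemma sum_poly_eq_0_imp_weights_0: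
  fixes c :: "nat \<Rightarrow> 'a::field_char_0"
  assumes "\<And>q. degree q < N \<Longrightarrow> (\<Sum>j<N. c j * poly q (of_nat j)) = 0" and "i < N"
  shows "c i = 0"
proof -
  define q :: "'a poly" where "q = (\<Prod>j\<in>{..<N} - {i}. [:- of_nat j, 1:])"
  have "degree q = card ({..<N} - {i})"
    unfolding q_def by (subst degree_prod_sum_eq) auto
  then have "(\<Sum>j<N. c j * poly q (of_nat j)) = 0"
    using assms by simp
  moreover have "(\<Sum>j<N. c j * poly q (of_nat j)) = (\<Sum>j\<in>{i}. c j * poly q (of_nat j))"
    using assms(2) by (intro sum.mono_neutral_right) (auto simp: q_def poly_prod)
  moreover have "poly q (of_nat i) \<noteq> 0"
    by (auto simp: q_def poly_prod)
  ultimately show ?thesis by simp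
qed

section \<open>Orthogonality as a condition on test polynomials\<close>

text \<open>Taken in the polynomial ring, \<open>pochhammer [:a, 1:] n\<close> is the rising
  factorial of a + x as a polynomial in x.\<close>

lemma degree_pochhammer_linear:
  fixes a :: "'a::idom"
  shows "degree (pochhammer [:a, 1:] n) = n" "pochhammer [:a, 1:] n \<noteq> 0"
proof -
  have eq: "[:a, 1:] + of_nat k = [:a + of_nat k, 1:]" for k
    by (simp add: of_nat_poly)
  show nz: "pochhammer [:a, 1:] n \<noteq> 0" for n
    by (auto simp: pochhammer_prod eq)
  show "degree (pochhammer [:a, 1:] n) = n"
    by (simp add: pochhammer_prod eq degree_prod_sum_eq)
qed

lemma poly_pochhammer: "poly (pochhammer p n) x = pochhammer (poly p x) n"
  by (simp add: pochhammer_prod poly_prod)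

lemma bessel_K_weight_moment:
  assumes "\<alpha> > -1" "\<alpha> + \<nu> > -1"
  shows "((\<lambda>x. x ^ k * bessel_K_weight \<alpha> \<nu> x) has_integral
           Gamma (\<alpha> + 1 + real k) * Gamma (\<alpha> + \<nu> + 1 + real k) / 2) {0<..}"
proof (rule has_integral_eq)
  show "((\<lambda>x. x powr (\<alpha> + 1 + k - 1 + \<nu> / 2) * bessel_K \<nu> (2 * sqrt x)) has_integral
           Gamma (\<alpha> + 1 + real k) * Gamma (\<alpha> + \<nu> + 1 + real k) / 2) {0<..}"
    using bessel_K_moment[of "\<alpha> + 1 + k" \<nu>] assms by (simp add: add_ac)
qed (simp add: bessel_K_weight_def powr_add powr_realpow)

text \<open>The Gamma product is twice the j-th moment of
  \<open>bessel_K_weight \<alpha> \<nu>\<close>. The test polynomial, evaluated at the exponent j,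
  encodes both the extra power of x and the passage to the second weight.\<close>

definition mop_functional :: "real \<Rightarrow> real \<Rightarrow> real poly \<Rightarrow> real poly \<Rightarrow> real" where
  "mop_functional \<alpha> \<nu> P q =
     (\<Sum>j\<le>degree P. coeff P j * (Gamma (\<alpha> + 1 + real j) * Gamma (\<alpha> + \<nu> + 1 + real j)) * poly q (real j))"

lemma Gamma_add_of_nat:
  assumes "(x :: real) > 0"
  shows "Gamma (x + real n) = Gamma x * pochhammer x n"
proof -
  have "x \<notin> \<int>\<^sub>\<le>\<^sub>0" using assms by (auto elim!: nonpos_Ints_cases)
  with assms show ?thesis by (simp add: pochhammer_Gamma less_imp_neq[OF Gamma_real_pos, symmetric])
qed

text \<open>Multiplying by x^k and raising \<nu> by i shift the two Gamma arguments by k and k + i;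
  by the functional equation this costs Pochhammer factors that are polynomial in j. The values i =
  0 and i = 1 give the two weights.\<close>

lemma mop_integral:
  assumes "\<alpha> > -1" "\<alpha> + \<nu> > -1"
  shows "((\<lambda>x. x ^ k * poly P x * bessel_K_weight \<alpha> (\<nu> + real i) x) has_integral
           mop_functional \<alpha> \<nu> P (pochhammer [:\<alpha> + 1, 1:] k * pochhammer [:\<alpha> + \<nu> + 1, 1:] (k + i)) / 2) {0<..}"
proof -
  let ?w = "bessel_K_weight \<alpha> (\<nu> + real i)"
  have "((\<lambda>x. \<Sum>j\<le>degree P. coeff P j * (x ^ (j + k) * ?w x)) has_integral
      (\<Sum>j\<le>degree P. coeff P j *
        (Gamma (\<alpha> + 1 + real (j + k)) * Gamma (\<alpha> + (\<nu> + real i) + 1 + real (j + k)) / 2))) {0<..}"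
    using assms by (intro has_integral_sum has_integral_mult_right bessel_K_weight_moment) auto
  moreover have "(\<lambda>x. \<Sum>j\<le>degree P. coeff P j * (x ^ (j + k) * ?w x)) = (\<lambda>x. x ^ k * poly P x * ?w x)"
    by (simp add: poly_altdef sum_distrib_left sum_distrib_right power_add mult_ac)
  moreover have "Gamma (\<alpha> + 1 + real (j + k)) * Gamma (\<alpha> + (\<nu> + real i) + 1 + real (j + k)) =
      (Gamma (\<alpha> + 1 + real j) * Gamma (\<alpha> + \<nu> + 1 + real j)) *
      poly (pochhammer [:\<alpha> + 1, 1:] k * pochhammer [:\<alpha> + \<nu> + 1, 1:] (k + i)) (real j)" for j
    using Gamma_add_of_nat[of "\<alpha> + 1 + j" k] Gamma_add_of_nat[of "\<alpha> + \<nu> + 1 + j" "k + i"] assms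
    by (simp add: poly_pochhammer add_ac)
  ultimately show ?thesis
    by (simp add: mop_functional_def sum_divide_distrib mult.assoc)
qed

text \<open>The first weight supplies test polynomials of the even degrees 2k with k < n, the second
  those of the odd degrees 2k + 1 with k < m. For n = m or n = m + 1 these degrees are exactly 0,
  ..., n + m - 1, each once, so both families together amount to all test polynomials of degree
  below n + m.\<close>

lemma is_bessel_K_mop_iff:
  assumes "\<alpha> > -1" "\<alpha> + \<nu> > -1" and nm: "n = m \<or> n = Suc m"
  shows "is_bessel_K_mop \<alpha> \<nu> n m P \<longleftrightarrow>
    degree P = n + m \<and> lead_coeff P = 1 \<and> (\<forall>q. degree q < n + m \<longrightarrow> mop_functional \<alpha> \<nu> P q = 0)"
proof -
  define R where "R k i = pochhammer [:\<alpha> + 1, 1:] k * pochhammer [:\<alpha> + \<nu> + 1, 1:] (k + i)" for k i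
  have R: "degree (R k i) = k + (k + i)" "R k i \<noteq> 0" for k i
    by (simp_all add: R_def degree_mult_eq degree_pochhammer_linear)
  have *: "((\<lambda>x. x ^ k * poly P x * bessel_K_weight \<alpha> (\<nu> + real i) x) has_integral 0) {0<..} \<longleftrightarrow>
      mop_functional \<alpha> \<nu> P (R k i) = 0" for k i
  proof
    assume "((\<lambda>x. x ^ k * poly P x * bessel_K_weight \<alpha> (\<nu> + real i) x) has_integral 0) {0<..}"
    from has_integral_unique[OF mop_integral[OF assms(1,2)] this]
    show "mop_functional \<alpha> \<nu> P (R k i) = 0" by (simp add: R_def)
  next
    assume "mop_functional \<alpha> \<nu> P (R k i) = 0"
    then show "((\<lambda>x. x ^ k * poly P x * bessel_K_weight \<alpha> (\<nu> + real i) x) has_integral 0) {0<..}"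
      using mop_integral[OF assms(1,2), of k P i] by (simp add: R_def)
  qed
  have orth: "is_bessel_K_mop \<alpha> \<nu> n m P \<longleftrightarrow> degree P = n + m \<and> lead_coeff P = 1 \<and>
      (\<forall>k<n. mop_functional \<alpha> \<nu> P (R k 0) = 0) \<and> (\<forall>k<m. mop_functional \<alpha> \<nu> P (R k 1) = 0)"
    unfolding is_bessel_K_mop_def *[symmetric] by simp
  have "(\<forall>q. degree q < n + m \<longrightarrow> mop_functional \<alpha> \<nu> P q = 0)"
    if "\<forall>k<n. mop_functional \<alpha> \<nu> P (R k 0) = 0" "\<forall>k<m. mop_functional \<alpha> \<nu> P (R k 1) = 0"
  proof (intro allI impI)
    fix q :: "real poly" assume q: "degree q < n + m"
    \<comment> \<open>The parity of the degree i selects the weight, and \<open>i div 2\<close> is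
      the power of x.\<close>
    have "mop_functional \<alpha> \<nu> P (R (i div 2) (i mod 2)) = 0" if "i < n + m" for i
    proof (cases "even i")
      case True
      then have "i mod 2 = 0" "i div 2 < n" using that nm by auto
      then show ?thesis using \<open>\<forall>k<n. _\<close> by simp
    next
      case False
      then have "i mod 2 = 1" "i div 2 < m" using that nm by presburger+
      then show ?thesis using \<open>\<forall>k<m. _\<close> by simp
    qed
    moreover have "degree (R (i div 2) (i mod 2)) = i" for i
      unfolding R by presburger
    ultimately have "degree (R (i div 2) (i mod 2)) = i \<and> R (i div 2) (i mod 2) \<noteq> 0 \<and>
        mop_functional \<alpha> \<nu> P (R (i div 2) (i mod 2)) = 0" if "i < n + m" for i
      using R(2) that by blast
    from sum_poly_eq_0_from_basis[OF this[unfolded mop_functional_def] q]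
    show "mop_functional \<alpha> \<nu> P q = 0"
      unfolding mop_functional_def by simp
  qed
  moreover have "degree (R k 0) < n + m" if "k < n" for k using that nm by (auto simp: R)
  moreover have "degree (R k 1) < n + m" if "k < m" for k using that nm by (auto simp: R)
  ultimately show ?thesis unfolding orth by blast
qed

section \<open>The explicit polynomial and its uniqueness\<close>

text \<open>This is (-1)^n (a)_n (b)_n 1F2(-n; a, b; x), since (-n)_j / j! = (-1)^j (n choose j).
  For positive a and b the prefactor makes it monic.\<close>

definition bessel_K_explicit :: "real \<Rightarrow> real \<Rightarrow> nat \<Rightarrow> real poly" where
  "bessel_K_explicit a b n = (\<Sum>j\<le>n. monom
     ((-1) ^ n * pochhammer a n * pochhammer b n * ((-1) ^ j * real (n choose j) / (pochhammer a j * pochhammer b j))) j)"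

text \<open>The formula needs no restriction to j \<le> n, because the binomial coefficient vanishes
  beyond n.\<close>

lemma coeff_bessel_K_explicit:
  "coeff (bessel_K_explicit a b n) j = 
     (-1) ^ n * pochhammer a n * pochhammer b n * ((-1) ^ j * real (n choose j) / (pochhammer a j * pochhammer b j))"
  by (simp add: bessel_K_explicit_def coeff_sum if_distrib cong: if_cong)

lemma bessel_K_explicit_monic:
  assumes "a > 0" "b > 0"
  shows "degree (bessel_K_explicit a b n) = n" "lead_coeff (bessel_K_explicit a b n) = 1"
proof -
  have c: "coeff (bessel_K_explicit a b n) n = 1"
    using pochhammer_pos[OF assms(1), of n] pochhammer_pos[OF assms(2), of n]
    by (simp add: coeff_bessel_K_explicit flip: power_mult_distrib)
  have "degree (bessel_K_explicit a b n) \<le> n"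
    by (rule degree_le) (simp add: coeff_bessel_K_explicit)
  moreover have "n \<le> degree (bessel_K_explicit a b n)"
    by (rule le_degree) (simp add: c)
  ultimately show "degree (bessel_K_explicit a b n) = n" by simp
  with c show "lead_coeff (bessel_K_explicit a b n) = 1" by simp
qed

text \<open>Existence: the Pochhammer denominators cancel against the Gamma moments, leaving an
  alternating binomial sum. Uniqueness: two monic solutions differ by N coefficients whose weighted
  sums vanish against all test polynomials of degree below N.\<close>

lemma is_bessel_K_mop_iff_explicit:
  assumes "\<alpha> > -1" "\<alpha> + \<nu> > -1" and nm: "n = m \<or> n = Suc m"
  shows "is_bessel_K_mop \<alpha> \<nu> n m P \<longleftrightarrow> P = bessel_K_explicit (\<alpha> + 1) (\<alpha> + \<nu> + 1) (n + m)"
proof -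
  define N where "N = n + m"
  define E where "E = bessel_K_explicit (\<alpha> + 1) (\<alpha> + \<nu> + 1) N"
  define g where "g j = Gamma (\<alpha> + 1 + real j) * Gamma (\<alpha> + \<nu> + 1 + real j)" for j
  have g: "g j > 0" for j
    using assms by (auto simp: g_def intro!: mult_pos_pos Gamma_real_pos)
  have E: "degree E = N" "lead_coeff E = 1"
    unfolding E_def by (rule bessel_K_explicit_monic; use assms in simp)+
  have E_orth: "mop_functional \<alpha> \<nu> E q = 0" if q: "degree q < N" for q
  proof -
    have pos: "pochhammer (\<alpha> + 1) j > 0" "pochhammer (\<alpha> + \<nu> + 1) j > 0" for j
      using assms by (auto intro!: pochhammer_pos)
    have "coeff E j * g j = ((-1) ^ N * pochhammer (\<alpha> + 1) N * pochhammer (\<alpha> + \<nu> + 1) N *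
        (Gamma (\<alpha> + 1) * Gamma (\<alpha> + \<nu> + 1))) * ((-1) ^ j * real (N choose j))" for j
      using assms pos[of j]
      by (simp add: g_def E_def coeff_bessel_K_explicit Gamma_add_of_nat)
    then have "mop_functional \<alpha> \<nu> E q = ((-1) ^ N * pochhammer (\<alpha> + 1) N * pochhammer (\<alpha> + \<nu> + 1) N *
        (Gamma (\<alpha> + 1) * Gamma (\<alpha> + \<nu> + 1))) * (\<Sum>j\<le>N. (-1) ^ j * real (N choose j) * poly q (real j))"
      unfolding mop_functional_def g_def[symmetric] E(1) by (simp add: sum_distrib_left mult.assoc)
    with alternating_binomial_sum_poly[OF q] show ?thesis by simp
  qed
  have iff: "is_bessel_K_mop \<alpha> \<nu> n m Q \<longleftrightarrow> degree Q = N \<and> lead_coeff Q = 1 \<and>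
      (\<forall>q. degree q < N \<longrightarrow> mop_functional \<alpha> \<nu> Q q = 0)" for Q
    unfolding N_def by (rule is_bessel_K_mop_iff[OF assms])
  have "P = E" if "is_bessel_K_mop \<alpha> \<nu> n m P"
  proof (rule poly_eqI)
    have P: "degree P = N" "lead_coeff P = 1"
      and P_orth: "degree q < N \<Longrightarrow> mop_functional \<alpha> \<nu> P q = 0" for q
      using that by (auto simp: iff)
    fix i
    have top: "coeff P N = coeff E N" using P E by simp
    have "(coeff P i - coeff E i) * g i = 0" if "i < N"
    proof (rule sum_poly_eq_0_imp_weights_0[OF _ that])
      fix q :: "real poly" assume q: "degree q < N"
      \<comment> \<open>Both polynomials are monic of degree N, so the term j = N vanishes and only
        N nodes remain, as the interpolation argument requires.\<close>
      have "(\<Sum>j<N. (coeff P j - coeff E j) * g j * poly q (real j)) =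
          (\<Sum>j\<le>N. (coeff P j - coeff E j) * g j * poly q (real j))"
        by (simp add: top flip: lessThan_Suc_atMost)
      also have "\<dots> = mop_functional \<alpha> \<nu> P q - mop_functional \<alpha> \<nu> E q"
        unfolding mop_functional_def g_def[symmetric] E P
        by (simp add: sum_subtractf algebra_simps)
      finally show "(\<Sum>j<N. (coeff P j - coeff E j) * g j * poly q (real j)) = 0"
        using P_orth E_orth q by simp
    qed
    then show "coeff P i = coeff E i"
      using g[of i] top P E by (cases i N rule: linorder_cases) (auto simp: coeff_eq_0)
  qed
  moreover have "is_bessel_K_mop \<alpha> \<nu> n m E"
    using E E_orth by (simp add: iff)
  ultimately show ?thesis unfolding E_def N_def by blast
qed

text \<open>The characterization is an equivalence with an equation for P, so the definite
  description in \<open>bessel_K_mop\<close> collapses to the explicit polynomial; both parities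
  have indices adding up to n.\<close>

lemma bessel_K_step_explicit:
  assumes "\<alpha> > -1" "\<alpha> + \<nu> > -1"
  shows "bessel_K_step \<alpha> \<nu> n = bessel_K_explicit (\<alpha> + 1) (\<alpha> + \<nu> + 1) n"
proof -
  have mop: "bessel_K_mop \<alpha> \<nu> k m = bessel_K_explicit (\<alpha> + 1) (\<alpha> + \<nu> + 1) (k + m)"
    if "k = m \<or> k = Suc m" for k m
    unfolding bessel_K_mop_def is_bessel_K_mop_iff_explicit[OF assms that] by simp
  show ?thesis
  proof (cases "even n")
    case True
    then have "n div 2 + n div 2 = n" by auto
    with True show ?thesis by (simp add: bessel_K_step_def mop)
  next
    case False
    then have "n div 2 + 1 + n div 2 = n" by presburger
    with False show ?thesis by (simp add: bessel_K_step_def mop)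
  qed
qed

section \<open>Convergence of the rescaled polynomials\<close>

lemma summable_0F2_majorant:
  fixes a b R :: real
  assumes "a > 0" "b > 0" "R \<ge> 0"
  shows "summable (\<lambda>k. R ^ k / (pochhammer a k * pochhammer b k * fact k))"
proof -
  \<comment> \<open>From here on a * b * (k + 1) \<ge> 2 * R; since (a + k) * (b + k) \<ge> a * b,
    the ratio of successive terms is at most 1/2.\<close>
  obtain N where N: "real N > 2 * R / (a * b)"
    using reals_Archimedean2 by blast
  have ratio: "R / ((a + real k) * (b + real k) * real (Suc k)) \<le> 1 / 2" if "k \<ge> N" for k
  proof -
    have "2 * R / (a * b) \<le> real (Suc k)"
      using N that by linarith
    then have "2 * R \<le> a * b * real (Suc k)"
      using assms by (simp add: pos_divide_le_eq mult_ac)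
    also have "\<dots> \<le> (a + real k) * (b + real k) * real (Suc k)"
      using assms by (intro mult_right_mono mult_mono) auto
    finally show ?thesis
      using assms by (subst pos_divide_le_eq) (auto intro!: mult_pos_pos)
  qed
  show ?thesis
  proof (rule summable_ratio_test)
    fix k assume "k \<ge> N"
    let ?f = "\<lambda>k. R ^ k / (pochhammer a k * pochhammer b k * fact k)"
    have nonneg: "?f k \<ge> 0" for k
      using assms pochhammer_pos[of a k] pochhammer_pos[of b k] by simp
    have "?f (Suc k) = R / ((a + real k) * (b + real k) * real (Suc k)) * ?f k"
      by (simp add: pochhammer_rec' mult_ac)
    also have "\<dots> \<le> 1 / 2 * ?f k"
      using ratio[OF \<open>k \<ge> N\<close>] nonneg by (intro mult_right_mono) auto
    finally show "norm (?f (Suc k)) \<le> 1 / 2 * norm (?f k)"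
      using nonneg[of k] nonneg[of "Suc k"] by (simp only: real_norm_def abs_of_nonneg)
  qed simp
qed

text \<open>For \<open>k \<le> n\<close> this is \<open>(- 1) ^ k * pochhammer (- n) k / n ^ k\<close>, the factor by which the
  terms of the rescaled polynomial differ from those of the limit series.\<close>

definition falling_ratio :: "nat \<Rightarrow> nat \<Rightarrow> real" where
  "falling_ratio n k = real (n choose k) * fact k / real n ^ k"

lemma falling_ratio_bounds: "n > 0 \<Longrightarrow> 0 \<le> falling_ratio n k" "n > 0 \<Longrightarrow> falling_ratio n k \<le> 1"
proof -
  assume n: "n > 0"
  show "0 \<le> falling_ratio n k" by (simp add: falling_ratio_def)
  have "real ((n choose k) * fact k) \<le> real (n ^ k)"
    by (intro of_nat_mono binomial_fact_pow)
  with n show "falling_ratio n k \<le> 1" by (simp add: falling_ratio_def)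
qed

text \<open>For fixed k the ratio is a product of k factors 1 - i/n, each tending to 1.\<close>

lemma falling_ratio_tendsto: "(\<lambda>n. falling_ratio n k) \<longlonglongrightarrow> 1"
proof -
  have "falling_ratio n k = (\<Prod>i<k. (real n - real i) / real n)" for n
    by (simp add: falling_ratio_def binomial_gbinomial gbinomial_prod_rev prod_dividef atLeast0LessThan)
  moreover have "(\<lambda>n. \<Prod>i<k. (real n - real i) / real n) \<longlonglongrightarrow> (\<Prod>i<k. 1)"
  proof (intro tendsto_prod)
    fix i
    have "(\<lambda>n. 1 - real i / real n) \<longlonglongrightarrow> 1 - 0"
      by (intro tendsto_diff tendsto_const lim_const_over_n)
    \<comment> \<open>At n = 0, where division yields 0, the two expressions differ, so they agree
      only eventually.\<close>
    moreover have "eventually (\<lambda>n. 1 - real i / real n = (real n - real i) / real n) sequentially"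
      using eventually_gt_at_top[of 0] by eventually_elim (simp add: diff_divide_distrib)
    ultimately show "(\<lambda>n. (real n - real i) / real n) \<longlonglongrightarrow> 1"
      by (simp add: Lim_transform_eventually)
  qed
  ultimately show ?thesis by simp
qed

text \<open>This series will bound the error at every point of the compact set at once. For n > 0
  the factor \<open>1 - falling_ratio n k\<close> lies in [0, 1], so \<open>M\<close> itself is the
  majorant for Tannery's theorem.\<close>

lemma falling_ratio_series_tendsto:
  fixes M :: "nat \<Rightarrow> real"
  assumes "summable M" "\<And>k. M k \<ge> 0"
  shows "(\<lambda>n. \<Sum>k. (1 - falling_ratio n k) * M k) \<longlonglongrightarrow> 0"
proof -
  have "(\<lambda>n. \<Sum>k. (1 - falling_ratio n k) * M k) \<longlonglongrightarrow> (\<Sum>k. (1 - 1) * M k)"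
  proof (rule tannerys_theorem[THEN conjunct2, THEN conjunct2])
    show "\<forall>\<^sub>F (k, n) in at_top \<times>\<^sub>F sequentially. norm ((1 - falling_ratio n k) * M k) \<le> M k"
    proof -
      have "\<forall>\<^sub>F x in at_top \<times>\<^sub>F sequentially. True \<and> snd x > (0 :: nat)"
        by (rule eventually_prodI[where P = "\<lambda>_. True" and Q = "\<lambda>n. n > 0"])
           (simp_all add: eventually_gt_at_top)
      then show ?thesis
        by (rule eventually_mono)
           (use falling_ratio_bounds assms(2) in \<open>auto simp: abs_mult intro!: mult_left_le_one_le\<close>)
    qed
    show "(\<lambda>n. (1 - falling_ratio n k) * M k) \<longlonglongrightarrow> (1 - 1) * M k" for k
      by (intro tendsto_intros falling_ratio_tendsto)
  qed (use assms in auto)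
  then show ?thesis by simp
qed

text \<open>Evaluating at z/n contributes 1/n^k, which combines with the binomial coefficient into
  \<open>falling_ratio n k / fact k\<close>. Writing the polynomial as an infinite series allows
  termwise comparison with the limit.\<close>

lemma scaled_bessel_K_explicit:
  fixes z :: complex and n :: nat
  assumes "a > 0" "b > 0" "n > 0"
  shows "(-1) ^ n * poly (map_poly complex_of_real (bessel_K_explicit a b n)) (z / of_nat n)
               / complex_of_real (pochhammer a n * pochhammer b n) =
     (\<Sum>k. of_real (falling_ratio n k) *
        ((- z) ^ k / (pochhammer (of_real a) k * pochhammer (of_real b) k * fact k)))"
proof -
  have pos: "pochhammer a k > 0" "pochhammer b k > 0" for k
    using assms by (auto intro!: pochhammer_pos)
  have sgn: "(-1) ^ n * ((-1) ^ n * x) = x" for x :: complex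
    by (simp add: mult.assoc[symmetric] flip: power_mult_distrib)
  have "poly (map_poly complex_of_real (bessel_K_explicit a b n)) (z / of_nat n) =
      (\<Sum>k\<le>n. of_real (coeff (bessel_K_explicit a b n) k) * (z / of_nat n) ^ k)"
    using bessel_K_explicit_monic[OF assms(1,2), of n]
    by (simp add: poly_altdef degree_map_poly coeff_map_poly)
  also have "\<dots> = (\<Sum>k\<le>n. (-1) ^ n * (of_real (pochhammer a n * pochhammer b n) * 
      (of_real (falling_ratio n k) *
        ((- z) ^ k / (pochhammer (of_real a) k * pochhammer (of_real b) k * fact k)))))"
    using pos assms
    by (intro sum.cong refl)
       (simp add: coeff_bessel_K_explicit falling_ratio_def pochhammer_of_real power_divide power_minus[of z] mult_ac)
  also have "\<dots> = (-1) ^ n * (of_real (pochhammer a n * pochhammer b n) *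
      (\<Sum>k\<le>n. of_real (falling_ratio n k) *
        ((- z) ^ k / (pochhammer (of_real a) k * pochhammer (of_real b) k * fact k))))"
    by (simp only: sum_distrib_left)
  finally have "(-1) ^ n * poly (map_poly complex_of_real (bessel_K_explicit a b n)) (z / of_nat n)
               / complex_of_real (pochhammer a n * pochhammer b n) = (\<Sum>k\<le>n. of_real (falling_ratio n k) *
        ((- z) ^ k / (pochhammer (of_real a) k * pochhammer (of_real b) k * fact k)))"
    using pos[of n] by (simp add: sgn)
  also have "\<dots> = (\<Sum>k. of_real (falling_ratio n k) *
        ((- z) ^ k / (pochhammer (of_real a) k * pochhammer (of_real b) k * fact k)))"
    \<comment> \<open>Terms with k > n vanish because n choose k is 0.\<close>
    by (intro suminf_finite[symmetric]) (auto simp: falling_ratio_def)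
  finally show ?thesis .
qed

section \<open>Uniform limit on compact sets\<close>

theorem theorem6:
  fixes \<alpha> \<nu> :: real
  assumes "\<alpha> > -1" and "\<alpha> + \<nu> > -1"
  shows "\<forall>K :: complex set. compact K \<longrightarrow>
    uniform_limit K
      (\<lambda>n z. (-1) ^ n * poly (map_poly complex_of_real (bessel_K_step \<alpha> \<nu> n)) (z / of_nat n)
               / complex_of_real (pochhammer (\<alpha> + 1) n * pochhammer (\<alpha> + \<nu> + 1) n))
      (\<lambda>z. hypergeo_0F2 (complex_of_real (\<alpha> + 1)) (complex_of_real (\<alpha> + \<nu> + 1)) (- z))
      sequentially"
proof (intro allI impI)
  fix K :: "complex set" assume "compact K"
  define a b where "a = \<alpha> + 1" and "b = \<alpha> + \<nu> + 1"
  have ab: "a > 0" "b > 0" using assms by (auto simp: a_def b_def)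
  obtain R where R: "R > 0" "\<And>z. z \<in> K \<Longrightarrow> norm z \<le> R"
    using compact_imp_bounded[OF \<open>compact K\<close>] by (auto simp: bounded_pos)
  \<comment> \<open>The terms of the limit series at radius R, which dominate \<open>t z k\<close>
    for every z in K.\<close>
  define M where "M k = R ^ k / (pochhammer a k * pochhammer b k * fact k)" for k
  define t where "t z k = (- z) ^ k / (pochhammer (of_real a) k * pochhammer (of_real b) k * fact k)"
    for z :: complex and k
  have M: "summable M" "M k \<ge> 0" for k
    using summable_0F2_majorant[of a b R] ab R pochhammer_pos[of a k] pochhammer_pos[of b k]
    by (auto simp: M_def[abs_def])
  have t: "norm (t z k) \<le> M k" if "z \<in> K" for z k
    using that ab R pochhammer_pos[of a k] pochhammer_pos[of b k]
    by (auto simp: t_def M_def pochhammer_of_real norm_divide norm_mult norm_power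
        intro!: divide_right_mono power_mono)
  \<comment> \<open>The right-hand side does not depend on z; this is where uniformity on K comes
    from.\<close>
  have close: "dist (\<Sum>k. of_real (falling_ratio n k) * t z k) (hypergeo_0F2 (of_real a) (of_real b) (- z))
      \<le> (\<Sum>k. (1 - falling_ratio n k) * M k)" if z: "z \<in> K" and n: "n > 0" for z n
  proof -
    note fr = falling_ratio_bounds[OF n]
    have s1: "summable (t z)"
      by (rule summable_comparison_test'[OF M(1)]) (use t z in auto)
    have nb: "norm (of_real (falling_ratio n k) * t z k) \<le> M k" for k
      using fr[of k] t[OF z, of k] by (simp add: norm_mult) (meson mult_left_le_one_le norm_ge_zero order.trans)
    have s2: "summable (\<lambda>k. of_real (falling_ratio n k) * t z k)"
      by (rule summable_comparison_test'[OF M(1)]) (use nb in auto)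
    have s3: "summable (\<lambda>k. (1 - falling_ratio n k) * M k)"
      by (rule summable_comparison_test'[OF M(1)])
         (use fr M in \<open>auto simp: abs_mult intro!: mult_left_le_one_le\<close>)
    have "hypergeo_0F2 (of_real a) (of_real b) (- z) - (\<Sum>k. of_real (falling_ratio n k) * t z k)
        = (\<Sum>k. t z k - of_real (falling_ratio n k) * t z k)"
      using suminf_diff[OF s1 s2] by (simp add: hypergeo_0F2_def t_def[abs_def])
    also have "norm \<dots> \<le> (\<Sum>k. (1 - falling_ratio n k) * M k)"
    proof (rule norm_suminf_le[OF _ s3])
      fix k
      have "t z k - of_real (falling_ratio n k) * t z k = of_real (1 - falling_ratio n k) * t z k"
        by (simp add: algebra_simps)
      then show "norm (t z k - of_real (falling_ratio n k) * t z k) \<le> (1 - falling_ratio n k) * M k"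
        using fr[of k] t[OF z, of k] by (simp only: norm_mult norm_of_real) (auto intro!: mult_left_mono)
    qed
    finally show ?thesis by (simp add: dist_norm norm_minus_commute)
  qed
  show "uniform_limit K
      (\<lambda>n z. (-1) ^ n * poly (map_poly complex_of_real (bessel_K_step \<alpha> \<nu> n)) (z / of_nat n)
               / complex_of_real (pochhammer (\<alpha> + 1) n * pochhammer (\<alpha> + \<nu> + 1) n))
      (\<lambda>z. hypergeo_0F2 (complex_of_real (\<alpha> + 1)) (complex_of_real (\<alpha> + \<nu> + 1)) (- z))
      sequentially"
  proof (rule uniform_limitI)
    fix e :: real assume "e > 0"
    have "eventually (\<lambda>n. (\<Sum>k. (1 - falling_ratio n k) * M k) < e) sequentially"
      using falling_ratio_series_tendsto[OF M] \<open>e > 0\<close> by (rule order_tendstoD)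
    then show "\<forall>\<^sub>F n in sequentially. \<forall>z\<in>K. dist
        ((-1) ^ n * poly (map_poly complex_of_real (bessel_K_step \<alpha> \<nu> n)) (z / of_nat n)
               / complex_of_real (pochhammer (\<alpha> + 1) n * pochhammer (\<alpha> + \<nu> + 1) n))
        (hypergeo_0F2 (complex_of_real (\<alpha> + 1)) (complex_of_real (\<alpha> + \<nu> + 1)) (- z)) < e"
      using eventually_gt_at_top[of 0]
    proof eventually_elim
      case (elim n)
      show ?case
      proof
        fix z assume "z \<in> K"
        from close[OF this elim(2)] elim(1) show "dist
          ((-1) ^ n * poly (map_poly complex_of_real (bessel_K_step \<alpha> \<nu> n)) (z / of_nat n)
               / complex_of_real (pochhammer (\<alpha> + 1) n * pochhammer (\<alpha> + \<nu> + 1) n))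
          (hypergeo_0F2 (complex_of_real (\<alpha> + 1)) (complex_of_real (\<alpha> + \<nu> + 1)) (- z)) < e"
          using scaled_bessel_K_explicit[OF ab elim(2), of z]
          unfolding bessel_K_step_explicit[OF assms] a_def[symmetric] b_def[symmetric] t_def
          by simp
      qed
    qed
  qed
qed

end
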